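(* Let $\kappa_1,\kappa_2\in\mathbb{R}$ and $(x_0,y_0)\in\mathbb{R}^2$, and let $\omega(x_0,y_0;\kappa_1,\kappa_2)$ denote the rotation number of the orbit of $(x_0,y_0)$ under the lift of the map $\mathcal{T}_{\kappa_1\kappa_2}$. Then, whenever the limit defining $\omega(x_0,y_0;\kappa_1,\kappa_2)$ exists, the following relations hold: \begin{align*} \omega(x_0+1/2,\,y_0;\,-\kappa_1,-\kappa_2)&=\omega(x_0,y_0;\kappa_1,\kappa_2),\\ \omega(x_0,\,y_0+1/2;\,\kappa_1,-\kappa_2)&=\omega(x_0,y_0;\kappa_1,\kappa_2)+1,\\ \omega(x_0+1/2,\,y_0+1/2;\,-\kappa_1,\kappa_2)&=\omega(x_0,y_0;\kappa_1,\kappa_2)+1,\\ \omega(1-x_0,\,1-y_0;\,\kappa_1,\kappa_2)&=2-\omega(x_0,y_0;\kappa_1,\kappa_2),\\ \omega(\mathcal{S}_{\kappa_2}^{-1}(x_0,y_0);\,\kappa_2,\kappa_1)&=\omega(x_0,y_0;\kappa_1,\kappa_2). \end{align*}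
   Context: For $\epsilon\in\mathbb{R}$, the (lift of the) standard map is $\mathcal{S}_\epsilon:\mathbb{R}^2\to\mathbb{R}^2$, $\mathcal{S}_\epsilon(x,y)=\left(x+y+\frac{\epsilon}{2\pi}\sin(2\pi x),\; y+\frac{\epsilon}{2\pi}\sin(2\pi x)\right)$, with inverse $\mathcal{S}_\epsilon^{-1}(x,y)=\left(x-y,\; y-\frac{\epsilon}{2\pi}\sin(2\pi(x-y))\right)$. The lift of $\mathcal{T}_{\kappa_1\kappa_2}$ is $\mathcal{S}_{\kappa_2}\circ\mathcal{S}_{\kappa_1}:\mathbb{R}^2\to\mathbb{R}^2$ (no reduction mod $1$ in $x$). Denote by $(x_n(x_0,y_0;\kappa_1,\kappa_2),\,y_n(x_0,y_0;\kappa_1,\kappa_2))$ the $n$-th iterate of $(x_0,y_0)$ under this lift. The rotation number is $\omega(x_0,y_0;\kappa_1,\kappa_2)=\lim_{n\to\infty}\frac{x_n(x_0,y_0;\kappa_1,\kappa_2)-x_0}{n}$, whenever the limit exists. *)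

theory Defs
  imports Complex_Main
begin

definition standard_map :: "real \<Rightarrow> real \<times> real \<Rightarrow> real \<times> real" where
  "standard_map \<epsilon> = (\<lambda>(x, y).
     (x + y + \<epsilon> / (2 * pi) * sin (2 * pi * x),
      y + \<epsilon> / (2 * pi) * sin (2 * pi * x)))"

lemma bij_standard_map: "bij (standard_map \<epsilon>)"
proof (rule o_bij)
  let ?g = "\<lambda>(x, y). (x - y, y - \<epsilon> / (2 * pi) * sin (2 * pi * (x - y)))"
  show "?g \<circ> standard_map \<epsilon> = id" "standard_map \<epsilon> \<circ> ?g = id"
    by (auto simp: standard_map_def fun_eq_iff)
qed

lemma inv_standard_map:
  "inv (standard_map \<epsilon>) (x, y) =
     (x - y, y - \<epsilon> / (2 * pi) * sin (2 * pi * (x - y)))"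
  by (rule inv_f_eq[OF bij_is_inj[OF bij_standard_map]]) (simp add: standard_map_def)

definition lift_T :: "real \<Rightarrow> real \<Rightarrow> real \<times> real \<Rightarrow> real \<times> real" where
  "lift_T \<kappa>\<^sub>1 \<kappa>\<^sub>2 = standard_map \<kappa>\<^sub>2 \<circ> standard_map \<kappa>\<^sub>1"

text \<open>The term for \<open>n = 0\<close> is \<open>0\<close> by the convention for division by zero; it does not
  affect the limit.\<close>

definition mean_displacement :: "real \<times> real \<Rightarrow> real \<Rightarrow> real \<Rightarrow> nat \<Rightarrow> real" where
  "mean_displacement p \<kappa>\<^sub>1 \<kappa>\<^sub>2 n = (fst ((lift_T \<kappa>\<^sub>1 \<kappa>\<^sub>2 ^^ n) p) - fst p) / real n"

definition rotation_number_exists :: "real \<times> real \<Rightarrow> real \<Rightarrow> real \<Rightarrow> bool" where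
  "rotation_number_exists p \<kappa>\<^sub>1 \<kappa>\<^sub>2 \<longleftrightarrow> convergent (mean_displacement p \<kappa>\<^sub>1 \<kappa>\<^sub>2)"

text \<open>Only meaningful if \<^const>\<open>rotation_number_exists\<close> holds: \<^const>\<open>lim\<close> returns an
  unspecified value for a divergent sequence.\<close>

definition rotation_number :: "real \<times> real \<Rightarrow> real \<Rightarrow> real \<Rightarrow> real" where
  "rotation_number p \<kappa>\<^sub>1 \<kappa>\<^sub>2 = lim (mean_displacement p \<kappa>\<^sub>1 \<kappa>\<^sub>2)"

end

theory Submission
  imports Defs
begin

text \<open>
  The first four relations are instances of one fact. Consider an affine map
  \<open>A(x, y) = (\<sigma>x + u, \<sigma>y + v)\<close>. If the force term \<open>\<mu> sin(2\<pi>x)\<close> of one standard map, taken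
  at \<open>A(x, y)\<close>, is \<open>\<sigma>\<close> times the force term \<open>\<kappa> sin(2\<pi>x)\<close> of another at \<open>(x, y)\<close>,
  then \<open>A\<close> carries the second map to the first, except that the
  offset of \<open>x\<close> grows by \<open>v\<close> (\<open>standard_map_affine\<close>). One step of the composed map thus adds
  \<open>2v\<close> to that offset. When \<open>2v\<close> is an integer the sine does not notice the change and the
  argument can be iterated, so after \<open>n\<close> steps the offset is \<open>u + 2nv\<close> and the rotation number
  becomes \<open>\<sigma>\<omega> + 2v\<close> (\<open>rotation_number_affine\<close>).

  The last relation is a conjugacy of a different kind: the inverse of the second factor
  conjugates \<open>S\<^sub>2 S\<^sub>1\<close> to \<open>S\<^sub>1 S\<^sub>2\<close>. As it shears \<open>x\<close> to \<open>x - y\<close>, which is not at bounded distance from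
  the identity, it preserves the rotation number only because the momentum grows sublinearly:
  \<open>x\<^sub>n\<^sub>+\<^sub>1 - x\<^sub>n\<close> is \<open>2y\<^sub>n\<close> up to a bounded error, and these increments are \<open>o(n)\<close> as soon
  as \<open>x\<^sub>n/n\<close> converges (\<open>momentum_sublinear\<close>).
\<close>

lemma rotation_numberI:
  assumes "mean_displacement p \<kappa>\<^sub>1 \<kappa>\<^sub>2 \<longlonglongrightarrow> L"
  shows "rotation_number_exists p \<kappa>\<^sub>1 \<kappa>\<^sub>2 \<and> rotation_number p \<kappa>\<^sub>1 \<kappa>\<^sub>2 = L"
  using assms
  by (auto simp: rotation_number_exists_def rotation_number_def convergent_def limI)

lemma mean_displacement_tendsto:
  assumes "rotation_number_exists p \<kappa>\<^sub>1 \<kappa>\<^sub>2"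
  shows "mean_displacement p \<kappa>\<^sub>1 \<kappa>\<^sub>2 \<longlonglongrightarrow> rotation_number p \<kappa>\<^sub>1 \<kappa>\<^sub>2"
  using assms unfolding rotation_number_exists_def rotation_number_def
  by (simp add: convergent_LIMSEQ_iff)

lemma standard_map_affine:
  assumes "\<And>x. \<mu> * sin (2 * pi * (\<sigma> * x + u)) = \<sigma> * (\<kappa> * sin (2 * pi * x))"
  shows "standard_map \<mu> (\<sigma> * x + u, \<sigma> * y + v) =
    (\<sigma> * fst (standard_map \<kappa> (x, y)) + (u + v), \<sigma> * snd (standard_map \<kappa> (x, y)) + v)"
proof -
  have "\<mu> / (2 * pi) * sin (2 * pi * (\<sigma> * x + u)) = \<sigma> * (\<kappa> / (2 * pi) * sin (2 * pi * x))"
    using assms[of x] by simp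
  then show ?thesis
    by (simp add: standard_map_def distrib_left)
qed

lemma sin_2pi_add_Ints:
  assumes "k \<in> \<int>"
  shows "sin (2 * pi * (x + k)) = sin (2 * pi * x)"
  using assms by (simp add: distrib_left sin_add sin_integer_2pi cos_integer_2pi)

lemma lift_T_apply:
  "lift_T \<kappa>\<^sub>1 \<kappa>\<^sub>2 p = standard_map \<kappa>\<^sub>2 (standard_map \<kappa>\<^sub>1 p)"
  by (simp add: lift_T_def)

lemma lift_T_funpow_affine:
  assumes first: "\<And>x. \<mu>\<^sub>1 * sin (2 * pi * (\<sigma> * x + u)) = \<sigma> * (\<kappa>\<^sub>1 * sin (2 * pi * x))"
    and second: "\<And>x. \<mu>\<^sub>2 * sin (2 * pi * (\<sigma> * x + (u + v))) = \<sigma> * (\<kappa>\<^sub>2 * sin (2 * pi * x))"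
    and v: "2 * v \<in> \<int>"
  shows "(lift_T \<mu>\<^sub>1 \<mu>\<^sub>2 ^^ n) (\<sigma> * x + u, \<sigma> * y + v) =
    (\<sigma> * fst ((lift_T \<kappa>\<^sub>1 \<kappa>\<^sub>2 ^^ n) (x, y)) + (u + real n * (2 * v)),
     \<sigma> * snd ((lift_T \<kappa>\<^sub>1 \<kappa>\<^sub>2 ^^ n) (x, y)) + v)"
proof (induction n)
  case 0
  then show ?case by simp
next
  case (Suc n)
  let ?k = "real n * (2 * v)"
  have k: "?k \<in> \<int>" using v by (intro Ints_mult[OF Ints_of_nat])
  have first': "\<mu>\<^sub>1 * sin (2 * pi * (\<sigma> * x + (u + ?k))) = \<sigma> * (\<kappa>\<^sub>1 * sin (2 * pi * x))" for x
    using first[of x] sin_2pi_add_Ints[OF k, of "\<sigma> * x + u"] by (simp only: add.assoc)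
  have second': "\<mu>\<^sub>2 * sin (2 * pi * (\<sigma> * x + (u + ?k + v))) = \<sigma> * (\<kappa>\<^sub>2 * sin (2 * pi * x))" for x
    using second[of x] sin_2pi_add_Ints[OF k, of "\<sigma> * x + (u + v)"]
    by (simp only: add.assoc add.commute[of v])
  obtain a b where ab: "(lift_T \<kappa>\<^sub>1 \<kappa>\<^sub>2 ^^ n) (x, y) = (a, b)" by force
  obtain c d where cd: "standard_map \<kappa>\<^sub>1 (a, b) = (c, d)" by force
  have "(lift_T \<mu>\<^sub>1 \<mu>\<^sub>2 ^^ Suc n) (\<sigma> * x + u, \<sigma> * y + v)
      = standard_map \<mu>\<^sub>2 (standard_map \<mu>\<^sub>1 (\<sigma> * a + (u + ?k), \<sigma> * b + v))"
    by (simp add: Suc.IH ab) (simp only: lift_T_apply)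
  also have "\<dots> = standard_map \<mu>\<^sub>2 (\<sigma> * c + (u + ?k + v), \<sigma> * d + v)"
    by (simp only: standard_map_affine[OF first'] cd fst_conv snd_conv)
  also have "\<dots> = (\<sigma> * fst (standard_map \<kappa>\<^sub>2 (c, d)) + (u + ?k + v + v),
      \<sigma> * snd (standard_map \<kappa>\<^sub>2 (c, d)) + v)"
    by (rule standard_map_affine[OF second'])
  also have "standard_map \<kappa>\<^sub>2 (c, d) = (lift_T \<kappa>\<^sub>1 \<kappa>\<^sub>2 ^^ Suc n) (x, y)"
    by (simp add: ab cd lift_T_apply)
  also have "u + ?k + v + v = u + real (Suc n) * (2 * v)"
    by (simp add: algebra_simps)
  finally show ?case .
qed

text \<open>
  The second force condition has offset \<open>u + v\<close> instead of \<open>u\<close> because the first factor has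
  already moved the offset by \<open>v\<close>. This is why a shift of \<open>y\<close> by \<open>1/2\<close> reverses the sign of
  exactly one of the two parameters.
\<close>

lemma rotation_number_affine:
  assumes ex: "rotation_number_exists (x, y) \<kappa>\<^sub>1 \<kappa>\<^sub>2"
    and first: "\<And>x. \<mu>\<^sub>1 * sin (2 * pi * (\<sigma> * x + u)) = \<sigma> * (\<kappa>\<^sub>1 * sin (2 * pi * x))"
    and second: "\<And>x. \<mu>\<^sub>2 * sin (2 * pi * (\<sigma> * x + (u + v))) = \<sigma> * (\<kappa>\<^sub>2 * sin (2 * pi * x))"
    and v: "2 * v \<in> \<int>"
  shows "rotation_number_exists (\<sigma> * x + u, \<sigma> * y + v) \<mu>\<^sub>1 \<mu>\<^sub>2 \<and>
    rotation_number (\<sigma> * x + u, \<sigma> * y + v) \<mu>\<^sub>1 \<mu>\<^sub>2 = \<sigma> * rotation_number (x, y) \<kappa>\<^sub>1 \<kappa>\<^sub>2 + 2 * v"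
proof (rule rotation_numberI, rule Lim_transform_eventually)
  show "(\<lambda>n. \<sigma> * mean_displacement (x, y) \<kappa>\<^sub>1 \<kappa>\<^sub>2 n + 2 * v)
      \<longlonglongrightarrow> \<sigma> * rotation_number (x, y) \<kappa>\<^sub>1 \<kappa>\<^sub>2 + 2 * v"
    by (intro tendsto_intros mean_displacement_tendsto ex)
  have "\<sigma> * mean_displacement (x, y) \<kappa>\<^sub>1 \<kappa>\<^sub>2 n + 2 * v
      = mean_displacement (\<sigma> * x + u, \<sigma> * y + v) \<mu>\<^sub>1 \<mu>\<^sub>2 n" if "n > 0" for n
    unfolding mean_displacement_def lift_T_funpow_affine[OF first second v]
    using that by (simp add: field_simps)
  then show "\<forall>\<^sub>F n in sequentially. \<sigma> * mean_displacement (x, y) \<kappa>\<^sub>1 \<kappa>\<^sub>2 n + 2 * v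
      = mean_displacement (\<sigma> * x + u, \<sigma> * y + v) \<mu>\<^sub>1 \<mu>\<^sub>2 n"
    by (rule eventually_mono[OF eventually_gt_at_top[of 0]])
qed

lemma lift_T_displacement_bound:
  "\<bar>fst (lift_T \<kappa>\<^sub>1 \<kappa>\<^sub>2 p) - fst p - 2 * snd p\<bar> \<le> 2 * \<bar>\<kappa>\<^sub>1 / (2 * pi)\<bar> + \<bar>\<kappa>\<^sub>2 / (2 * pi)\<bar>"
proof -
  obtain x y where p: "p = (x, y)" by force
  have force_bound: "\<bar>c * sin t\<bar> \<le> \<bar>c\<bar>" for c t :: real
    by (simp add: abs_mult mult_left_le)
  let ?f = "\<kappa>\<^sub>1 / (2 * pi) * sin (2 * pi * x)"
  let ?g = "\<kappa>\<^sub>2 / (2 * pi) * sin (2 * pi * (x + y + ?f))"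
  have "fst (lift_T \<kappa>\<^sub>1 \<kappa>\<^sub>2 p) - fst p - 2 * snd p = 2 * ?f + ?g"
    by (simp add: p lift_T_apply standard_map_def)
  moreover have "\<bar>?f\<bar> \<le> \<bar>\<kappa>\<^sub>1 / (2 * pi)\<bar>" "\<bar>?g\<bar> \<le> \<bar>\<kappa>\<^sub>2 / (2 * pi)\<bar>"
    by (rule force_bound)+
  ultimately show ?thesis by linarith
qed

lemma increment_sublinear:
  fixes a :: "nat \<Rightarrow> real"
  assumes "(\<lambda>n. a n / real n) \<longlonglongrightarrow> L"
  shows "(\<lambda>n. (a (Suc n) - a n) / real n) \<longlonglongrightarrow> 0"
proof (rule Lim_transform_eventually)
  have "(\<lambda>n. a (Suc n) / real (Suc n) * (real (Suc n) / real n) - a n / real n)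
      \<longlonglongrightarrow> L * 1 - L"
    by (intro tendsto_intros LIMSEQ_Suc[OF assms] assms LIMSEQ_Suc_n_over_n)
  then show "(\<lambda>n. a (Suc n) / real (Suc n) * (real (Suc n) / real n) - a n / real n)
      \<longlonglongrightarrow> 0"
    by simp
  show "\<forall>\<^sub>F n in sequentially.
      a (Suc n) / real (Suc n) * (real (Suc n) / real n) - a n / real n
        = (a (Suc n) - a n) / real n"
    by (simp add: diff_divide_distrib del: of_nat_Suc)
qed

lemma momentum_sublinear:
  assumes "rotation_number_exists p \<kappa>\<^sub>1 \<kappa>\<^sub>2"
  shows "(\<lambda>n. snd ((lift_T \<kappa>\<^sub>1 \<kappa>\<^sub>2 ^^ n) p) / real n) \<longlonglongrightarrow> 0"
proof -
  define x where "x n = fst ((lift_T \<kappa>\<^sub>1 \<kappa>\<^sub>2 ^^ n) p)" for n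
  define y where "y n = snd ((lift_T \<kappa>\<^sub>1 \<kappa>\<^sub>2 ^^ n) p)" for n
  define C where "C = 2 * \<bar>\<kappa>\<^sub>1 / (2 * pi)\<bar> + \<bar>\<kappa>\<^sub>2 / (2 * pi)\<bar>"
  have increment: "(\<lambda>n. (x (Suc n) - x n) / real n) \<longlonglongrightarrow> 0"
    using increment_sublinear[OF mean_displacement_tendsto[OF assms, unfolded mean_displacement_def]]
    by (simp add: x_def)
  have error: "(\<lambda>n. (x (Suc n) - x n - 2 * y n) / real n) \<longlonglongrightarrow> 0"
  proof (rule tendsto_0_le)
    have "\<bar>x (Suc n) - x n - 2 * y n\<bar> \<le> C" for n
      using lift_T_displacement_bound[of \<kappa>\<^sub>1 \<kappa>\<^sub>2 "(lift_T \<kappa>\<^sub>1 \<kappa>\<^sub>2 ^^ n) p"]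
      by (simp add: x_def y_def C_def)
    moreover have "C \<ge> 0" by (simp add: C_def)
    ultimately show "\<forall>\<^sub>F n in sequentially.
        norm ((x (Suc n) - x n - 2 * y n) / real n) \<le> norm (C / real n) * 1"
      by (simp add: divide_right_mono)
    show "(\<lambda>n. C / real n) \<longlonglongrightarrow> 0"
      by (rule lim_const_over_n)
  qed
  have "(\<lambda>n. ((x (Suc n) - x n) / real n - (x (Suc n) - x n - 2 * y n) / real n) / 2)
      \<longlonglongrightarrow> (0 - 0) / 2"
    by (intro tendsto_intros increment error) simp
  moreover have "((x (Suc n) - x n) / real n - (x (Suc n) - x n - 2 * y n) / real n) / 2
      = y n / real n" for n
    by (simp flip: diff_divide_distrib)
  ultimately have "(\<lambda>n. y n / real n) \<longlonglongrightarrow> 0"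
    by (simp only: diff_self div_0)
  then show ?thesis by (simp add: y_def)
qed

lemma lift_T_funpow_swap:
  "(lift_T \<kappa>\<^sub>2 \<kappa>\<^sub>1 ^^ n) (inv (standard_map \<kappa>\<^sub>2) p)
    = inv (standard_map \<kappa>\<^sub>2) ((lift_T \<kappa>\<^sub>1 \<kappa>\<^sub>2 ^^ n) p)"
proof (induction n)
  case 0
  then show ?case by simp
next
  case (Suc n)
  then show ?case
    by (simp add: lift_T_apply bij_is_surj[OF bij_standard_map] surj_f_inv_f
        bij_is_inj[OF bij_standard_map] inv_f_f)
qed

lemma rotation_number_swap:
  assumes ex: "rotation_number_exists p \<kappa>\<^sub>1 \<kappa>\<^sub>2"
  shows "rotation_number_exists (inv (standard_map \<kappa>\<^sub>2) p) \<kappa>\<^sub>2 \<kappa>\<^sub>1 \<and>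
    rotation_number (inv (standard_map \<kappa>\<^sub>2) p) \<kappa>\<^sub>2 \<kappa>\<^sub>1 = rotation_number p \<kappa>\<^sub>1 \<kappa>\<^sub>2"
proof (rule rotation_numberI)
  have shear: "fst (inv (standard_map \<kappa>\<^sub>2) q) = fst q - snd q" for q
    by (cases q) (simp add: inv_standard_map)
  have "(\<lambda>n. mean_displacement p \<kappa>\<^sub>1 \<kappa>\<^sub>2 n - snd ((lift_T \<kappa>\<^sub>1 \<kappa>\<^sub>2 ^^ n) p) / real n
        + snd p / real n) \<longlonglongrightarrow> rotation_number p \<kappa>\<^sub>1 \<kappa>\<^sub>2 - 0 + 0"
    by (intro tendsto_intros mean_displacement_tendsto[OF ex] momentum_sublinear[OF ex]
        lim_const_over_n)
  moreover have "mean_displacement p \<kappa>\<^sub>1 \<kappa>\<^sub>2 n - snd ((lift_T \<kappa>\<^sub>1 \<kappa>\<^sub>2 ^^ n) p) / real n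
      + snd p / real n = mean_displacement (inv (standard_map \<kappa>\<^sub>2) p) \<kappa>\<^sub>2 \<kappa>\<^sub>1 n" for n
    by (simp add: mean_displacement_def lift_T_funpow_swap shear
        flip: diff_divide_distrib add_divide_distrib)
  ultimately show "mean_displacement (inv (standard_map \<kappa>\<^sub>2) p) \<kappa>\<^sub>2 \<kappa>\<^sub>1
      \<longlonglongrightarrow> rotation_number p \<kappa>\<^sub>1 \<kappa>\<^sub>2"
    by simp
qed

theorem mainTheorem2:
  fixes \<kappa>\<^sub>1 \<kappa>\<^sub>2 x\<^sub>0 y\<^sub>0 :: real
  assumes "rotation_number_exists (x\<^sub>0, y\<^sub>0) \<kappa>\<^sub>1 \<kappa>\<^sub>2"
  shows
    "(rotation_number_exists (x\<^sub>0 + 1/2, y\<^sub>0) (- \<kappa>\<^sub>1) (- \<kappa>\<^sub>2) \<and>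
      rotation_number (x\<^sub>0 + 1/2, y\<^sub>0) (- \<kappa>\<^sub>1) (- \<kappa>\<^sub>2) = rotation_number (x\<^sub>0, y\<^sub>0) \<kappa>\<^sub>1 \<kappa>\<^sub>2) \<and>
     (rotation_number_exists (x\<^sub>0, y\<^sub>0 + 1/2) \<kappa>\<^sub>1 (- \<kappa>\<^sub>2) \<and>
      rotation_number (x\<^sub>0, y\<^sub>0 + 1/2) \<kappa>\<^sub>1 (- \<kappa>\<^sub>2) = rotation_number (x\<^sub>0, y\<^sub>0) \<kappa>\<^sub>1 \<kappa>\<^sub>2 + 1) \<and>
     (rotation_number_exists (x\<^sub>0 + 1/2, y\<^sub>0 + 1/2) (- \<kappa>\<^sub>1) \<kappa>\<^sub>2 \<and>
      rotation_number (x\<^sub>0 + 1/2, y\<^sub>0 + 1/2) (- \<kappa>\<^sub>1) \<kappa>\<^sub>2 = rotation_number (x\<^sub>0, y\<^sub>0) \<kappa>\<^sub>1 \<kappa>\<^sub>2 + 1) \<and>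
     (rotation_number_exists (1 - x\<^sub>0, 1 - y\<^sub>0) \<kappa>\<^sub>1 \<kappa>\<^sub>2 \<and>
      rotation_number (1 - x\<^sub>0, 1 - y\<^sub>0) \<kappa>\<^sub>1 \<kappa>\<^sub>2 = 2 - rotation_number (x\<^sub>0, y\<^sub>0) \<kappa>\<^sub>1 \<kappa>\<^sub>2) \<and>
     (rotation_number_exists (inv (standard_map \<kappa>\<^sub>2) (x\<^sub>0, y\<^sub>0)) \<kappa>\<^sub>2 \<kappa>\<^sub>1 \<and>
      rotation_number (inv (standard_map \<kappa>\<^sub>2) (x\<^sub>0, y\<^sub>0)) \<kappa>\<^sub>2 \<kappa>\<^sub>1 = rotation_number (x\<^sub>0, y\<^sub>0) \<kappa>\<^sub>1 \<kappa>\<^sub>2)"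
proof (intro conjI[where P = "_ \<and> _"])
  have half: "sin (2 * pi * (x + 1/2)) = - sin (2 * pi * x)" for x
    by (simp add: distrib_left)
  have one: "sin (2 * pi * (x + 1)) = sin (2 * pi * x)" for x
    by (rule sin_2pi_add_Ints) simp
  have reflect: "sin (2 * pi * (k - x)) = - sin (2 * pi * x)" if "k \<in> \<int>" for k x
    using sin_2pi_add_Ints[OF that, of "- x"] by simp
  note affine = rotation_number_affine[OF assms]
  show "rotation_number_exists (x\<^sub>0 + 1/2, y\<^sub>0) (- \<kappa>\<^sub>1) (- \<kappa>\<^sub>2) \<and>
      rotation_number (x\<^sub>0 + 1/2, y\<^sub>0) (- \<kappa>\<^sub>1) (- \<kappa>\<^sub>2) = rotation_number (x\<^sub>0, y\<^sub>0) \<kappa>\<^sub>1 \<kappa>\<^sub>2"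
    using affine[of "- \<kappa>\<^sub>1" 1 "1/2" "- \<kappa>\<^sub>2" 0] half by simp
  show "rotation_number_exists (x\<^sub>0, y\<^sub>0 + 1/2) \<kappa>\<^sub>1 (- \<kappa>\<^sub>2) \<and>
      rotation_number (x\<^sub>0, y\<^sub>0 + 1/2) \<kappa>\<^sub>1 (- \<kappa>\<^sub>2) = rotation_number (x\<^sub>0, y\<^sub>0) \<kappa>\<^sub>1 \<kappa>\<^sub>2 + 1"
    using affine[of \<kappa>\<^sub>1 1 0 "- \<kappa>\<^sub>2" "1/2"] half by simp
  show "rotation_number_exists (x\<^sub>0 + 1/2, y\<^sub>0 + 1/2) (- \<kappa>\<^sub>1) \<kappa>\<^sub>2 \<and>
      rotation_number (x\<^sub>0 + 1/2, y\<^sub>0 + 1/2) (- \<kappa>\<^sub>1) \<kappa>\<^sub>2 = rotation_number (x\<^sub>0, y\<^sub>0) \<kappa>\<^sub>1 \<kappa>\<^sub>2 + 1"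
    using affine[of "- \<kappa>\<^sub>1" 1 "1/2" \<kappa>\<^sub>2 "1/2"] half one by simp
  (* The first factor sees x |-> 1 - x and the second x |-> 2 - x; sin(2 pi x) is odd about
     both centres 1/2 and 1, so neither parameter changes sign. *)
  show "rotation_number_exists (1 - x\<^sub>0, 1 - y\<^sub>0) \<kappa>\<^sub>1 \<kappa>\<^sub>2 \<and>
      rotation_number (1 - x\<^sub>0, 1 - y\<^sub>0) \<kappa>\<^sub>1 \<kappa>\<^sub>2 = 2 - rotation_number (x\<^sub>0, y\<^sub>0) \<kappa>\<^sub>1 \<kappa>\<^sub>2"
    using affine[of \<kappa>\<^sub>1 "- 1" 1 \<kappa>\<^sub>2 1] reflect[of 1] reflect[of 2] by simp
  show "rotation_number_exists (inv (standard_map \<kappa>\<^sub>2) (x\<^sub>0, y\<^sub>0)) \<kappa>\<^sub>2 \<kappa>\<^sub>1 \<and>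
      rotation_number (inv (standard_map \<kappa>\<^sub>2) (x\<^sub>0, y\<^sub>0)) \<kappa>\<^sub>2 \<kappa>\<^sub>1 = rotation_number (x\<^sub>0, y\<^sub>0) \<kappa>\<^sub>1 \<kappa>\<^sub>2"
    by (rule rotation_number_swap[OF assms])
qed

end
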